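(* Let $S$ be a $*$-monoid and let $a,b,c\in S$ satisfy $(ab)^{*}=ab$ and $(ac)^{*}=ac$. Then the following conditions are equivalent: (1) $a$ is both $(b,c)$-invertible and $(c,b)$-invertible, $Sb=Sb^{2}$ and $Sc=Sc^{2}$; (2) $ba$ is left $(c,b)$-invertible and $ca$ is left $(b,c)$-invertible.
   Context: A $*$-monoid is a monoid $S$ with an involution, i.e. a map $*:S\to S$ with $(a^{*})^{*}=a$ and $(ab)^{*}=b^{*}a^{*}$ for all $a,b\in S$. For $a,b,c\in S$: $a$ is $(b,c)$-invertible if there exists $y\in S$ with $y\in bSy\cap ySc$, $yab=b$, $cay=c$. $a$ is left $(b,c)$-invertible if $b\in Scab$ (equivalently, there is $x\in Sc$ with $xab=b$). The notions with $(c,b)$, or applied to other elements in place of $a$, are obtained by substitution. *)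

theory Defs
  imports Main
begin

class star_monoid = monoid_mult +
  fixes star :: "'a \<Rightarrow> 'a"
  assumes star_star: "star (star a) = a"
    and star_mult: "star (a * b) = star b * star a"

text \<open>In the two predicates below the element whose invertibility is asserted comes last:
  bc_invertible b c a says that a is (b,c)-invertible.\<close>

definition bc_invertible :: "'a::monoid_mult \<Rightarrow> 'a \<Rightarrow> 'a \<Rightarrow> bool" where
  "bc_invertible b c a \<longleftrightarrow>
     (\<exists>y. y \<in> {b * s * y |s. True} \<inter> {y * s * c |s. True} \<and> y * a * b = b \<and> c * a * y = c)"

definition left_bc_invertible :: "'a::monoid_mult \<Rightarrow> 'a \<Rightarrow> 'a \<Rightarrow> bool" where
  "left_bc_invertible b c a \<longleftrightarrow> b \<in> {s * c * a * b |s. True}"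

definition left_principal :: "'a::monoid_mult \<Rightarrow> 'a set" where
  "left_principal b = {s * b |s. True}"

end

theory Submission
  imports Defs
begin

text \<open>Write p = ab and q = ac. From b = v c^2 p one gets p = a v c^2 p, and applying the involution
  puts c^* directly to the right of p. Since c = u b^2 q gives c^* = q b^* b^* u^*, this yields
  p \<in> pqS and hence b \<in> bacS; exchanging b and c gives c \<in> cabS. So the two one-sided conditions of (2)
  imply the missing right-hand ones, and substituting b = v c^2 ab into c = cabt gives
  c = c a v c^2, that is Sc = Sc^2.\<close>

lemma left_bc_invertible_iff: "left_bc_invertible b c a \<longleftrightarrow> (\<exists>s. b = s * c * a * b)"
  by (auto simp: left_bc_invertible_def)

text \<open>The inclusion of Sb^2 in Sb is automatic; as S has an identity, the reverse one is
  decided by the generator \<open>b\<close> alone.\<close>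

lemma left_principal_square_iff:
  "left_principal b = left_principal (b ^ 2) \<longleftrightarrow> (\<exists>t. b = t * b ^ 2)"
proof
  assume eq: "left_principal b = left_principal (b ^ 2)"
  have "b \<in> left_principal b"
    unfolding left_principal_def using mult_1_left[of b, symmetric] by blast
  with eq show "\<exists>t. b = t * b ^ 2"
    by (auto simp: left_principal_def)
next
  assume "\<exists>t. b = t * b ^ 2"
  then obtain t where t: "b = t * b ^ 2" ..
  have "s * b = s * t * b ^ 2" for s
    by (subst t) (simp add: mult.assoc)
  moreover have "s * b ^ 2 = s * b * b" for s
    by (simp add: power2_eq_square mult.assoc)
  ultimately show "left_principal b = left_principal (b ^ 2)"
    unfolding left_principal_def by blast
qed

text \<open>Writing \<open>y = y * s * c\<close> in \<open>y * a * b = b\<close> exhibits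
  \<open>b\<close> as \<open>(y * s) * c * a * b\<close>.\<close>

lemma bc_invertible_imp_left:
  assumes "bc_invertible b c a"
  shows "left_bc_invertible b c a"
  using assms unfolding bc_invertible_def left_bc_invertible_iff by auto metis

text \<open>Evaluating \<open>x * c * a * b * t\<close> in two ways gives
  \<open>x * c = b * t\<close>, just as a left and a right inverse coincide. This common value is
  the required \<open>y\<close>.\<close>

lemma bc_invertibleI:
  assumes left: "b = x * c * a * b" and right: "c = c * a * b * t"
  shows "bc_invertible b c a"
proof -
  define y where "y = x * c"
  have y: "y = b * t"
  proof -
    have "y = (x * c * a * b) * t"
      unfolding y_def by (subst right) (simp add: mult.assoc)
    with left show ?thesis by simp
  qed
  have yab: "y * a * b = b"
    using left by (simp add: y_def)
  have cay: "c * a * y = c"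
    using right by (simp add: y mult.assoc)
  have yay: "y * a * y = y"
    using cay by (simp add: y_def mult.assoc)
  \<comment> \<open>Both memberships come from \<open>y * a * y = y\<close>: the first factor
    \<open>y\<close> is read as \<open>b * t\<close>, and below the last one as
    \<open>x * c\<close>.\<close>
  have "y = b * (t * a) * y"
    using yay y by (simp add: mult.assoc)
  moreover have "y = y * (a * x) * c"
    using yay y_def by (simp add: mult.assoc)
  ultimately show ?thesis
    unfolding bc_invertible_def using yab cay by blast
qed

lemma left_invertible_mult_imp_right:
  fixes a b c :: "'a::star_monoid"
  assumes p: "star (a * b) = a * b" and q: "star (a * c) = a * c"
    and b: "b = v * c * (c * a) * b" and c: "c = u * b * (b * a) * c"
  shows "\<exists>t. b = b * a * c * t"
proof -
  \<comment> \<open>This is what remains of \<open>star (a * v * c * c)\<close> once its leading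
    \<open>star c\<close> is expanded and \<open>a * c\<close> is split off.\<close>
  define w where "w = star b * star b * star u * star c * star v * star a"
  have "star c = star (u * b * b * (a * c))"
    by (subst c) (simp add: mult.assoc)
  then have star_c: "star c = a * c * star b * star b * star u"
    \<comment> \<open>The instance keeps \<open>a * c\<close> whole, so that \<open>q\<close>
      applies before the other products are split.\<close>
    by (simp add: star_mult[of _ "a * c"] q) (simp add: star_mult mult.assoc)
  have "a * b = a * v * c * c * (a * b)"
    by (subst b) (simp add: mult.assoc)
  then have "star (a * b) = star (a * v * c * c * (a * b))"
    by (rule arg_cong)
  then have "a * b = a * b * star (a * v * c * c)"
    by (simp add: star_mult[of _ "a * b"] p)
  also have "star (a * v * c * c) = star c * (star c * star v * star a)"
    by (simp add: star_mult mult.assoc)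
  also have "\<dots> = a * c * w"
    by (subst star_c) (simp add: w_def mult.assoc)
  finally have ab: "a * b = a * b * (a * c * w)" .
  have "b = v * c * c * (a * b)"
    using b by (simp add: mult.assoc)
  also have "\<dots> = v * c * c * (a * b * (a * c * w))"
    by (subst ab) (rule refl)
  also have "\<dots> = (v * c * (c * a) * b) * a * c * w"
    by (simp add: mult.assoc)
  also have "\<dots> = b * a * c * w"
    by (simp flip: b)
  finally show ?thesis ..
qed

lemma square_factor:
  fixes a b c :: "'a::monoid_mult"
  assumes b: "b = v * c * (c * a) * b" and c: "c = c * a * b * t"
  shows "\<exists>s. c = s * c ^ 2"
proof -
  have "c = c * a * (v * c * (c * a) * b) * t"
    using c by (simp flip: b)
  also have "\<dots> = c * a * v * c * (c * a * b * t)"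
    by (simp add: mult.assoc)
  also have "\<dots> = c * a * v * c * c"
    by (simp flip: c)
  also have "\<dots> = c * a * v * c ^ 2"
    by (simp add: power2_eq_square mult.assoc)
  finally show ?thesis ..
qed

text \<open>The equation for \<open>b\<close> supplies the extra factor \<open>b\<close> that turns
  \<open>b * a\<close> into \<open>b * (b * a)\<close>; this carries (1) to (2).\<close>

lemma left_invertible_mult:
  assumes "left_bc_invertible c b a" "b = t * b ^ 2"
  shows "left_bc_invertible c b (b * a)"
proof -
  obtain s where "c = s * b * a * c"
    using assms(1) by (auto simp: left_bc_invertible_iff)
  also have "\<dots> = s * (t * b ^ 2) * a * c"
    by (simp flip: assms(2))
  also have "\<dots> = s * t * b * (b * a) * c"
    by (simp add: power2_eq_square mult.assoc)
  finally show ?thesis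
    unfolding left_bc_invertible_iff ..
qed

theorem theorem4p1:
  fixes a b c :: "'a::star_monoid"
  assumes "star (a * b) = a * b"
    and "star (a * c) = a * c"
  shows "(bc_invertible b c a \<and> bc_invertible c b a \<and>
           left_principal b = left_principal (b ^ 2) \<and>
           left_principal c = left_principal (c ^ 2)) \<longleftrightarrow>
         (left_bc_invertible c b (b * a) \<and> left_bc_invertible b c (c * a))"
    (is "?L \<longleftrightarrow> ?R")
proof
  assume ?L
  then show ?R
    unfolding left_principal_square_iff
    by (blast intro: left_invertible_mult bc_invertible_imp_left)
next
  assume ?R
  then obtain u v where c: "c = u * b * (b * a) * c" and b: "b = v * c * (c * a) * b"
    unfolding left_bc_invertible_iff by blast
  obtain r where r: "b = b * a * c * r"
    using left_invertible_mult_imp_right[OF assms b c] by blast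
  obtain t where t: "c = c * a * b * t"
    using left_invertible_mult_imp_right[OF assms(2,1) c b] by blast
  \<comment> \<open>Regrouping exposes the witnesses \<open>x = v * c\<close> and
    \<open>x = u * b\<close> for \<open>bc_invertibleI\<close>.\<close>
  have "b = (v * c) * c * a * b" "c = (u * b) * b * a * c"
    using b c by (simp_all add: mult.assoc)
  then have "bc_invertible b c a" "bc_invertible c b a"
    using bc_invertibleI t r by blast+
  moreover have "\<exists>s. b = s * b ^ 2" "\<exists>s. c = s * c ^ 2"
    using square_factor[OF c r] square_factor[OF b t] by blast+
  ultimately show ?L
    unfolding left_principal_square_iff by blast
qed

end
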